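(* In the battery-sharing model described in the context, suppose that at least one user is net demanding (i.e. $\Delta_i<0$ for some $i\in[n]$) but the system is net generative (i.e. $\Delta=\sum_{i\in[n]}\Delta_i>0$). Then the price of fairness satisfies $\mathrm{PoF}\to\infty$ as $b_{\max}\to\infty$.
   Context: Notation: $[n]=\{1,\dots,n\}$; $\mathbb{I}\{\cdot\}$ denotes an indicator. Net generation. There are $n$ users. The net generation of user $i$ at discrete time $t$ is $X_i(t)\in S_i\subset\mathbb{Z}$ (positive: surplus; negative: deficit), where $S_i$ has $\max S_i>0$ and $\min S_i<0$. The vector $X(t)=(X_1(t),\dots,X_n(t))$ is an irreducible discrete-time Markov chain on a finite state space $S\subseteq\prod_{i\in[n]}S_i$ (the users' processes need not be independent), with $\mathbb{P}[X(t+1)=s\mid X(t)=s]>0$ for all $s\in S$. Its stationary distribution is $\pi$. The drift of user $i$ is $\Delta_i=\sum_{s\in S}s_i\pi(s)$, where $s=(s_1,\dots,s_n)$, and the system drift is $\Delta=\sum_{i\in[n]}\Delta_i$. Battery. A shared battery of capacity $b_{\max}\in\mathbb{N}$ has level $B(t)\in\{0,\dots,b_{\max}\}$ and evolves as $B(t+1)=B(t)+\sum_{i\in[n]}A_i(t)$, where $A_i(t)$ is the energy accepted from user $i$ (if $\ge0$) or supplied to user $i$ (if negative). In state $(x,b)\in S\times\{0,\dots,b_{\max}\}$ the set $A(x,b)$ of allowable actions consists of all integer vectors $(a_1,\dots,a_n)$ with $a_i\in\{0,\dots,x_i\}$ if $x_i\ge0$, $a_i\in\{x_i,\dots,0\}$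 if $x_i<0$, and $0\le b+\sum_{i}a_i\le b_{\max}$. A policy is a (possibly randomized, history-dependent) rule choosing at each time $t$ an action in $A(X(t),B(t))$ as a function of the history up to time $t$; the process $X$ evolves autonomously, unaffected by actions. The initial distribution of $(X(0),B(0))$ is fixed for each $b_{\max}$ (arbitrary). Loss of load rate: $\mathrm{LLR}_i=\lim_{T\to\infty}\frac1T\sum_{t=0}^T\mathbb{E}\big[\mathbb{I}\{X_i(t)<0\}(A_i(t)-X_i(t))\big]$ and $\mathrm{LLR}_{\rm sys}=\sum_{i\in[n]}\mathrm{LLR}_i$. $\mathrm{LLR}_o$ is the minimum of $\mathrm{LLR}_{\rm sys}$ over all policies satisfying, for every $i\in[n]$, the fairness constraint $\lim_{T\to\infty}\frac1T\sum_{t=0}^T\mathbb{E}[A_i(t)]\ge0$. $\mathrm{LLR}_e$ is the minimum of $\mathrm{LLR}_{\rm sys}$ over all policies (without the fairness constraint). Both depend on $b_{\max}$. The price of fairness is $\mathrm{PoF}=\mathrm{LLR}_o/\mathrm{LLR}_e$, read as $+\infty$ if $\mathrm{LLR}_e=0<\mathrm{LLR}_o$. *)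

theory Defs
  imports "HOL-Probability.Probability"
begin

text \<open>
  Users are indexed by a finite type \<open>'n\<close>.  A vector of net generations, or of actions, is a
  function \<open>'n \<Rightarrow> int\<close>.  Battery levels are integers; the capacity \<open>bmax\<close> is a natural number.
\<close>

type_synonym 'n energy = "'n \<Rightarrow> int"

type_synonym 'n kernel = "'n energy \<Rightarrow> 'n energy pmf"

definition kernel_iter :: "'n kernel \<Rightarrow> nat \<Rightarrow> 'n energy \<Rightarrow> 'n energy pmf" where
  "kernel_iter K k s = ((\<lambda>\<mu>. bind_pmf \<mu> K) ^^ k) (return_pmf s)"

text \<open>The values of \<open>K\<close> outside \<open>S\<close> are irrelevant.\<close>

definition irreducible_chain :: "'n energy set \<Rightarrow> 'n kernel \<Rightarrow> bool" where
  "irreducible_chain S K \<longleftrightarrow>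
     (\<forall>s\<in>S. set_pmf (K s) \<subseteq> S) \<and>
     (\<forall>s\<in>S. \<forall>s'\<in>S. \<exists>k. pmf (kernel_iter K k s) s' > 0)"

definition stationary :: "'n energy set \<Rightarrow> 'n kernel \<Rightarrow> 'n energy pmf \<Rightarrow> bool" where
  "stationary S K \<pi> \<longleftrightarrow> set_pmf \<pi> \<subseteq> S \<and> bind_pmf \<pi> K = \<pi>"

definition drift :: "'n energy set \<Rightarrow> 'n energy pmf \<Rightarrow> 'n \<Rightarrow> real" where
  "drift S \<pi> i = (\<Sum>s\<in>S. real_of_int (s i) * pmf \<pi> s)"

definition allowable :: "nat \<Rightarrow> 'n::finite energy \<Rightarrow> int \<Rightarrow> 'n energy set" where
  "allowable bmax x b =
     {a. (\<forall>i. if 0 \<le> x i then a i \<in> {0..x i} else a i \<in> {x i..0}) \<and>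
         0 \<le> b + (\<Sum>i\<in>UNIV. a i) \<and> b + (\<Sum>i\<in>UNIV. a i) \<le> int bmax}"

text \<open>
  The history before time \<open>t\<close> is the list of the triples \<open>(X(u), B(u), A(u))\<close> for \<open>u < t\<close>, in
  chronological order.  A policy maps it, together with the current \<open>X(t)\<close> and \<open>B(t)\<close>, to a
  distribution of the action \<open>A(t)\<close>; the time \<open>t\<close> is the length of the list.
\<close>

type_synonym 'n history = "('n energy \<times> int \<times> 'n energy) list"

type_synonym 'n policy = "'n history \<Rightarrow> 'n energy \<Rightarrow> int \<Rightarrow> 'n energy pmf"

definition policies :: "'n::finite energy set \<Rightarrow> nat \<Rightarrow> 'n policy set" where
  "policies S bmax =
     {p. \<forall>h. \<forall>x\<in>S. \<forall>b\<in>{0..int bmax}. set_pmf (p h x b) \<subseteq> allowable bmax x b}"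

definition choose_action ::
  "'n policy \<Rightarrow> ('n history \<times> 'n energy \<times> int) pmf \<Rightarrow>
   ('n history \<times> 'n energy \<times> int \<times> 'n energy) pmf" where
  "choose_action p \<mu> =
     bind_pmf \<mu> (\<lambda>(h, x, b). map_pmf (\<lambda>a. (h, x, b, a)) (p h x b))"

text \<open>
  \<open>state_law K \<mu> p t\<close> is the joint law of the history before \<open>t\<close>, \<open>X(t)\<close> and \<open>B(t)\<close> when
  \<open>(X(0), B(0))\<close> has law \<open>\<mu>\<close>; \<open>step_law\<close> is the joint law of these and \<open>A(t)\<close>.  Given the past,
  \<open>X(t+1)\<close> has law \<open>K (X(t))\<close>, whatever the actions were.
\<close>

primrec state_law ::
  "'n::finite kernel \<Rightarrow> ('n energy \<times> int) pmf \<Rightarrow> 'n policy \<Rightarrow> nat \<Rightarrow>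
   ('n history \<times> 'n energy \<times> int) pmf" where
  "state_law K \<mu> p 0 = map_pmf (\<lambda>(x, b). ([], x, b)) \<mu>"
| "state_law K \<mu> p (Suc t) =
     bind_pmf (choose_action p (state_law K \<mu> p t))
       (\<lambda>(h, x, b, a). map_pmf (\<lambda>x'. (h @ [(x, b, a)], x', b + (\<Sum>i\<in>UNIV. a i))) (K x))"

definition step_law ::
  "'n::finite kernel \<Rightarrow> ('n energy \<times> int) pmf \<Rightarrow> 'n policy \<Rightarrow> nat \<Rightarrow>
   ('n history \<times> 'n energy \<times> int \<times> 'n energy) pmf" where
  "step_law K \<mu> p t = choose_action p (state_law K \<mu> p t)"

definition mean_loss ::
  "'n::finite kernel \<Rightarrow> ('n energy \<times> int) pmf \<Rightarrow> 'n policy \<Rightarrow> 'n \<Rightarrow> nat \<Rightarrow> real" where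
  "mean_loss K \<mu> p i t =
     measure_pmf.expectation (step_law K \<mu> p t)
       (\<lambda>(h, x, b, a). if x i < 0 then real_of_int (a i - x i) else 0)"

definition mean_action ::
  "'n::finite kernel \<Rightarrow> ('n energy \<times> int) pmf \<Rightarrow> 'n policy \<Rightarrow> 'n \<Rightarrow> nat \<Rightarrow> real" where
  "mean_action K \<mu> p i t =
     measure_pmf.expectation (step_law K \<mu> p t) (\<lambda>(h, x, b, a). real_of_int (a i))"

definition time_avg :: "(nat \<Rightarrow> real) \<Rightarrow> nat \<Rightarrow> real" where
  "time_avg f T = (1 / real T) * (\<Sum>t=0..T. f t)"

definition LLR ::
  "'n::finite kernel \<Rightarrow> ('n energy \<times> int) pmf \<Rightarrow> 'n policy \<Rightarrow> 'n \<Rightarrow> real" where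
  "LLR K \<mu> p i = lim (time_avg (mean_loss K \<mu> p i))"

definition LLR_sys ::
  "'n::finite kernel \<Rightarrow> ('n energy \<times> int) pmf \<Rightarrow> 'n policy \<Rightarrow> real" where
  "LLR_sys K \<mu> p = (\<Sum>i\<in>UNIV. LLR K \<mu> p i)"

text \<open>
  \<open>lim\<close> is arbitrary on divergent sequences, so the minima range over the policies for which the
  limits in question exist.
\<close>

definition LLR_defined ::
  "'n::finite kernel \<Rightarrow> ('n energy \<times> int) pmf \<Rightarrow> 'n policy \<Rightarrow> bool" where
  "LLR_defined K \<mu> p \<longleftrightarrow> (\<forall>i. convergent (time_avg (mean_loss K \<mu> p i)))"

definition fair ::
  "'n::finite kernel \<Rightarrow> ('n energy \<times> int) pmf \<Rightarrow> 'n policy \<Rightarrow> bool" where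
  "fair K \<mu> p \<longleftrightarrow>
     (\<forall>i. convergent (time_avg (mean_action K \<mu> p i)) \<and>
          lim (time_avg (mean_action K \<mu> p i)) \<ge> 0)"

text \<open>The minima are written as infima, which have the same value whenever they are attained.\<close>

definition LLR_e ::
  "'n::finite energy set \<Rightarrow> 'n kernel \<Rightarrow> ('n energy \<times> int) pmf \<Rightarrow> nat \<Rightarrow> ereal" where
  "LLR_e S K \<mu> bmax =
     (INF p\<in>{p \<in> policies S bmax. LLR_defined K \<mu> p}. ereal (LLR_sys K \<mu> p))"

definition LLR_o ::
  "'n::finite energy set \<Rightarrow> 'n kernel \<Rightarrow> ('n energy \<times> int) pmf \<Rightarrow> nat \<Rightarrow> ereal" where
  "LLR_o S K \<mu> bmax =
     (INF p\<in>{p \<in> policies S bmax. LLR_defined K \<mu> p \<and> fair K \<mu> p}. ereal (LLR_sys K \<mu> p))"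

text \<open>In \<^typ>\<open>ereal\<close>, \<open>x / 0 = \<infinity>\<close> for \<open>x > 0\<close>, which is the required convention.\<close>

definition price_of_fairness ::
  "'n::finite energy set \<Rightarrow> 'n kernel \<Rightarrow> ('n energy \<times> int) pmf \<Rightarrow> nat \<Rightarrow> ereal" where
  "price_of_fairness S K \<mu> bmax = LLR_o S K \<mu> bmax / LLR_e S K \<mu> bmax"

end

theory Submission
  imports Defs
begin

text \<open>
  A user's loss is at least the accepted energy minus the net generation.  For a fair policy and a
  user with drift \<open>\<Delta>\<^sub>i < 0\<close>, averaging over time gives a loss rate of at least \<open>- \<Delta>\<^sub>i\<close>, whatever the
  capacity.  Without fairness, the positive system drift keeps a large battery almost always far
  from empty: for a policy that serves all demand unless the level is below a constant, a quadratic
  Lyapunov function of the headroom bounds the mean headroom independently of \<open>bmax\<close>, and by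
  Markov's inequality the loss rate is \<open>O(1 / bmax)\<close>.  The Lyapunov function is corrected by an
  approximate solution of Poisson's equation, built from the Cesaro averages of the chain.
\<close>

section \<open>Mean ergodic theorem for finite Markov chains\<close>


text \<open>Bolzano-Weierstrass, one point of \<open>C\<close> at a time: each insertion refines the
  previous subsequence, which preserves the limits already found.\<close>

lemma finite_set_convergent_subsequence:
  fixes a :: "nat \<Rightarrow> 'a \<Rightarrow> real"
  assumes "finite C" and "\<And>x k. x \<in> C \<Longrightarrow> \<bar>a k x\<bar> \<le> c"
  shows "\<exists>r u. strict_mono (r :: nat \<Rightarrow> nat) \<and> (\<forall>x\<in>C. (\<lambda>k. a (r k) x) \<longlonglongrightarrow> u x)"
  using assms
proof (induction C rule: finite_induct)
  case empty
  show ?case by (auto intro!: exI[of _ id] simp: strict_mono_id)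
next
  case (insert y C)
  then obtain r u where r: "strict_mono (r :: nat \<Rightarrow> nat)"
    and u: "\<And>x. x \<in> C \<Longrightarrow> (\<lambda>k. a (r k) x) \<longlonglongrightarrow> u x"
    by blast
  have "seq_compact {- c..c}"
    by (rule compact_imp_seq_compact) simp
  moreover have "\<forall>k. a (r k) y \<in> {- c..c}"
    using abs_le_D1[OF insert.prems] abs_le_D2[OF insert.prems] by (force simp: minus_le_iff[of c])
  ultimately obtain l q where q: "strict_mono (q :: nat \<Rightarrow> nat)"
    and l: "((\<lambda>k. a (r k) y) \<circ> q) \<longlonglongrightarrow> l"
    unfolding seq_compact_def by metis
  have "(\<lambda>k. a ((r \<circ> q) k) x) \<longlonglongrightarrow> (u(y := l)) x" if "x \<in> insert y C" for x
  proof (cases "x = y")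
    case True
    then show ?thesis using l by (simp add: o_def)
  next
    case False
    then have "((\<lambda>k. a (r k) x) \<circ> q) \<longlonglongrightarrow> u x"
      using that by (intro LIMSEQ_subseq_LIMSEQ u q) auto
    then show ?thesis using False by (simp add: o_def)
  qed
  then show ?case
    using strict_mono_o[OF r q] by blast
qed

section \<open>Transition operator, Cesaro averages and potentials\<close>

abbreviation chain_law :: "('a \<Rightarrow> 'a pmf) \<Rightarrow> 'a pmf \<Rightarrow> nat \<Rightarrow> 'a pmf" where
  "chain_law Q \<mu> t \<equiv> ((\<lambda>\<nu>. bind_pmf \<nu> Q) ^^ t) \<mu>"

text \<open>Instantiated twice: with the net generation on \<open>S\<close>, and with the pair of
  net generation and battery level under the threshold policy.\<close>

locale finite_chain =
  fixes C :: "'a set" and Q :: "'a \<Rightarrow> 'a pmf"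
  assumes finite_C: "finite C"
    and closed: "\<And>x. x \<in> C \<Longrightarrow> set_pmf (Q x) \<subseteq> C"
begin

definition P :: "('a \<Rightarrow> real) \<Rightarrow> 'a \<Rightarrow> real" where
  "P f x = measure_pmf.expectation (Q x) f"

definition cesaro :: "('a \<Rightarrow> real) \<Rightarrow> nat \<Rightarrow> 'a \<Rightarrow> real" where
  "cesaro f N x = (\<Sum>k<N. (P ^^ k) f x) / real N"

text \<open>The partial sums of the formal solution of Poisson's equation, the series of all
  \<open>(P ^^ j) f\<close>, averaged over their lengths.\<close>

definition potential :: "('a \<Rightarrow> real) \<Rightarrow> nat \<Rightarrow> 'a \<Rightarrow> real" where
  "potential f N x = (\<Sum>k<N. \<Sum>j<k. (P ^^ j) f x) / real N"

lemma expectation_eq_sum: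
  fixes f :: "'a \<Rightarrow> real"
  assumes "set_pmf \<mu> \<subseteq> C"
  shows "measure_pmf.expectation \<mu> f = (\<Sum>x\<in>C. f x * pmf \<mu> x)"
  using assms finite_C by (intro integral_measure_pmf_real) auto

lemma sum_pmf_C: "set_pmf \<mu> \<subseteq> C \<Longrightarrow> (\<Sum>x\<in>C. pmf \<mu> x) = 1"
  using finite_C by (rule sum_pmf_eq_1)

lemma P_eq_sum: "x \<in> C \<Longrightarrow> P f x = (\<Sum>y\<in>C. f y * pmf (Q x) y)"
  unfolding P_def by (rule expectation_eq_sum) (rule closed)

lemma P_cong: "(\<And>y. y \<in> C \<Longrightarrow> f y = g y) \<Longrightarrow> x \<in> C \<Longrightarrow> P f x = P g x"
  by (simp add: P_eq_sum)

lemma P_add: "x \<in> C \<Longrightarrow> P (\<lambda>y. f y + g y) x = P f x + P g x"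
  by (simp add: P_eq_sum distrib_right sum.distrib)

lemma P_cmult: "x \<in> C \<Longrightarrow> P (\<lambda>y. c * f y) x = c * P f x"
  by (simp add: P_eq_sum sum_distrib_left mult.assoc)

lemma P_diff: "x \<in> C \<Longrightarrow> P (\<lambda>y. f y - g y) x = P f x - P g x"
  by (simp add: P_eq_sum left_diff_distrib sum_subtractf)

lemma P_divide: "x \<in> C \<Longrightarrow> P (\<lambda>y. f y / c) x = P f x / c"
  by (simp add: P_eq_sum sum_divide_distrib)

lemma P_sum: "x \<in> C \<Longrightarrow> P (\<lambda>y. \<Sum>i\<in>I. f i y) x = (\<Sum>i\<in>I. P (f i) x)"
  by (simp add: P_eq_sum sum_distrib_right sum.swap[of _ I C])

lemma P_const: "x \<in> C \<Longrightarrow> P (\<lambda>y. c) x = c"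
  by (simp add: P_def)

lemma P_mono: "(\<And>y. y \<in> C \<Longrightarrow> f y \<le> g y) \<Longrightarrow> x \<in> C \<Longrightarrow> P f x \<le> P g x"
  by (auto simp: P_eq_sum intro!: sum_mono mult_right_mono)

lemma iter_cong: "(\<And>y. y \<in> C \<Longrightarrow> f y = g y) \<Longrightarrow> x \<in> C \<Longrightarrow> (P ^^ k) f x = (P ^^ k) g x"
  by (induction k arbitrary: x) (auto intro: P_cong)

lemma iter_add: "x \<in> C \<Longrightarrow> (P ^^ k) (\<lambda>y. f y + g y) x = (P ^^ k) f x + (P ^^ k) g x"
proof (induction k arbitrary: x)
  case (Suc k)
  have "(P ^^ Suc k) (\<lambda>y. f y + g y) x = P (\<lambda>y. (P ^^ k) f y + (P ^^ k) g y) x"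
    using Suc by (auto intro: P_cong)
  then show ?case using Suc.prems by (simp add: P_add)
qed simp

lemma iter_diff: "x \<in> C \<Longrightarrow> (P ^^ k) (\<lambda>y. f y - g y) x = (P ^^ k) f x - (P ^^ k) g x"
proof (induction k arbitrary: x)
  case (Suc k)
  have "(P ^^ Suc k) (\<lambda>y. f y - g y) x = P (\<lambda>y. (P ^^ k) f y - (P ^^ k) g y) x"
    using Suc by (auto intro: P_cong)
  then show ?case using Suc.prems by (simp add: P_diff)
qed simp

lemma iter_mono: "(\<And>y. y \<in> C \<Longrightarrow> f y \<le> g y) \<Longrightarrow> x \<in> C \<Longrightarrow> (P ^^ k) f x \<le> (P ^^ k) g x"
  by (induction k arbitrary: x) (auto intro: P_mono)

lemma iter_invariant:
  "(\<And>y. y \<in> C \<Longrightarrow> P f y = f y) \<Longrightarrow> x \<in> C \<Longrightarrow> (P ^^ k) f x = f x"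
proof (induction k arbitrary: x)
  case (Suc k)
  have "P ((P ^^ k) f) x = P f x"
    using Suc by (intro P_cong) auto
  then show ?case using Suc.prems by simp
qed simp

text \<open>Constants are invariant under \<open>P\<close>, and \<open>P\<close> is
  monotone.\<close>

lemma abs_iter_le:
  assumes "\<And>y. y \<in> C \<Longrightarrow> \<bar>f y\<bar> \<le> c" and "x \<in> C"
  shows "\<bar>(P ^^ k) f x\<bar> \<le> c"
proof -
  have "(P ^^ k) (\<lambda>_. d) x = d" for d
    using assms(2) by (intro iter_invariant) (simp_all add: P_const)
  moreover have "(P ^^ k) f x \<le> (P ^^ k) (\<lambda>_. c) x" "(P ^^ k) (\<lambda>_. - c) x \<le> (P ^^ k) f x"
    using assms by (auto intro!: iter_mono simp: abs_le_iff minus_le_iff[of c])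
  ultimately show ?thesis by (simp add: abs_le_iff)
qed

lemma abs_cesaro_le:
  assumes "\<And>y. y \<in> C \<Longrightarrow> \<bar>f y\<bar> \<le> c" and "x \<in> C" and "0 \<le> c"
  shows "\<bar>cesaro f N x\<bar> \<le> c"
proof (cases "N = 0")
  case False
  have "\<bar>\<Sum>k<N. (P ^^ k) f x\<bar> \<le> (\<Sum>k<N. c)"
    by (rule order_trans[OF sum_abs]) (intro sum_mono abs_iter_le assms)
  then show ?thesis
    using False by (simp add: cesaro_def field_simps)
qed (use assms in \<open>simp add: cesaro_def\<close>)

lemma bounded_on_C: "\<exists>c\<ge>0. \<forall>x\<in>C. \<bar>f x\<bar> \<le> c" for f :: "'a \<Rightarrow> real"
  using finite_C by (intro exI[of _ "\<Sum>x\<in>C. \<bar>f x\<bar>"]) (auto intro: member_le_sum sum_nonneg)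

text \<open>For a fixed length \<open>k\<close>, subtracting from the partial sum its image under
  \<open>P\<close> leaves \<open>f - (P ^^ k) f\<close> by telescoping. Averaging over
  \<open>k\<close> turns the last term into the Cesaro average.\<close>

lemma potential_equation:
  assumes "x \<in> C" "N > 0"
  shows "potential f N x - P (potential f N) x = f x - cesaro f N x"
proof -
  have "P (potential f N) x = (\<Sum>k<N. \<Sum>j<k. (P ^^ Suc j) f x) / real N"
    using assms(1) by (simp add: potential_def[abs_def] P_divide P_sum)
  also have "(\<Sum>k<N. \<Sum>j<k. (P ^^ Suc j) f x)
      = (\<Sum>k<N. (\<Sum>j<k. (P ^^ j) f x) + ((P ^^ k) f x - f x))"
  proof (rule sum.cong)
    fix k
    have "(\<Sum>j<k. (P ^^ Suc j) f x - (P ^^ j) f x) = (P ^^ k) f x - f x"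
      using sum_lessThan_telescope[of "\<lambda>j. (P ^^ j) f x" k] by simp
    then show "(\<Sum>j<k. (P ^^ Suc j) f x) = (\<Sum>j<k. (P ^^ j) f x) + ((P ^^ k) f x - f x)"
      by (simp add: sum_subtractf)
  qed simp
  finally have "P (potential f N) x
      = ((\<Sum>k<N. \<Sum>j<k. (P ^^ j) f x) + (\<Sum>k<N. (P ^^ k) f x) - real N * f x) / real N"
    by (simp add: sum.distrib sum_subtractf)
  then show ?thesis
    using assms(2) by (simp add: potential_def cesaro_def field_simps)
qed

text \<open>Telescoping leaves only the first and the last iterate, so these averages are of order
  \<open>1 / N\<close>.\<close>

lemma cesaro_coboundary:
  assumes "x \<in> C"
  shows "cesaro (\<lambda>y. h y - P h y) N x = (h x - (P ^^ N) h x) / real N"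
proof -
  have "(P ^^ k) (\<lambda>y. h y - P h y) x = (P ^^ k) h x - (P ^^ Suc k) h x" for k
    using assms by (simp add: iter_diff funpow_swap1)
  then have "(\<Sum>k<N. (P ^^ k) (\<lambda>y. h y - P h y) x) = h x - (P ^^ N) h x"
    using sum_lessThan_telescope'[of "\<lambda>k. (P ^^ k) h x" N] by simp
  then show ?thesis by (simp add: cesaro_def)
qed

text \<open>Applying \<open>P\<close> shifts the summation range by one, exchanging the iterate of
  index 0 for that of index \<open>N\<close>.\<close>

lemma P_cesaro:
  assumes "x \<in> C"
  shows "P (cesaro f N) x = cesaro f N x - (f x - (P ^^ N) f x) / real N"
proof -
  have "P (cesaro f N) x = (\<Sum>k<N. (P ^^ Suc k) f x) / real N"
    using assms by (simp add: cesaro_def[abs_def] P_divide P_sum)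
  moreover have "(\<Sum>k<N. (P ^^ k) f x - (P ^^ Suc k) f x) = f x - (P ^^ N) f x"
    using sum_lessThan_telescope'[of "\<lambda>k. (P ^^ k) f x" N] by simp
  ultimately show ?thesis
    by (simp add: cesaro_def sum_subtractf diff_divide_distrib[symmetric])
qed

text \<open>A cluster point \<open>u\<close> of the averages is invariant, and \<open>f\<close> minus an average is a coboundary
  \<open>h - P h\<close>, on which the averages vanish in the limit.  Hence all averages approach \<open>u\<close>.\<close>

theorem mean_ergodic:
  "\<exists>u. (\<forall>x\<in>C. P u x = u x) \<and> (\<forall>x\<in>C. (\<lambda>N. cesaro f N x) \<longlonglongrightarrow> u x)"
proof -
  obtain c where c: "c \<ge> 0" "\<And>x. x \<in> C \<Longrightarrow> \<bar>f x\<bar> \<le> c"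
    using bounded_on_C by blast
  have "\<exists>r u. strict_mono (r :: nat \<Rightarrow> nat) \<and> (\<forall>x\<in>C. (\<lambda>k. cesaro f (r k) x) \<longlonglongrightarrow> u x)"
    using finite_C c abs_cesaro_le by (intro finite_set_convergent_subsequence) blast+
  then obtain r u where r: "strict_mono (r :: nat \<Rightarrow> nat)"
    and u: "\<And>x. x \<in> C \<Longrightarrow> (\<lambda>k. cesaro f (r k) x) \<longlonglongrightarrow> u x"
    by blast
  have vanish: "(\<lambda>N. (h x - (P ^^ N) h x) / real N) \<longlonglongrightarrow> 0" if x: "x \<in> C" for h x
  proof -
    obtain d where d: "d \<ge> 0" "\<And>x. x \<in> C \<Longrightarrow> \<bar>h x\<bar> \<le> d"
      using bounded_on_C by blast
    have iter: "\<bar>(P ^^ N) h x\<bar> \<le> d" for N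
      by (rule abs_iter_le) (use d x in auto)
    have "\<bar>h x - (P ^^ N) h x\<bar> \<le> 2 * d" for N
      using d(2)[OF x] iter[of N] by linarith
    then have "\<forall>N. norm ((h x - (P ^^ N) h x) / real N) \<le> (2 * d) / real N"
      by (simp add: divide_right_mono)
    then show ?thesis
      by (rule Lim_null_comparison[OF always_eventually]) (rule lim_const_over_n)
  qed
  have inv: "P u x = u x" if x: "x \<in> C" for x
  proof (rule LIMSEQ_unique)
    \<comment> \<open>Being a finite sum, \<open>P\<close> commutes with pointwise limits. The same
      sequence also tends to \<open>u x\<close>, because \<open>P\<close> barely changes a long
      average.\<close>
    have "(\<lambda>k. \<Sum>y\<in>C. cesaro f (r k) y * pmf (Q x) y) \<longlonglongrightarrow> (\<Sum>y\<in>C. u y * pmf (Q x) y)"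
      by (intro tendsto_sum tendsto_mult_right u)
    then show "(\<lambda>k. P (cesaro f (r k)) x) \<longlonglongrightarrow> P u x"
      using x by (simp add: P_eq_sum)
    have "(\<lambda>k. cesaro f (r k) x - (f x - (P ^^ r k) f x) / real (r k)) \<longlonglongrightarrow> u x - 0"
      using LIMSEQ_subseq_LIMSEQ[OF vanish[OF x] r]
      by (intro tendsto_diff u x) (simp add: o_def)
    then show "(\<lambda>k. P (cesaro f (r k)) x) \<longlonglongrightarrow> u x"
      using x by (simp add: P_cesaro)
  qed
  have "(\<lambda>N. cesaro f N x) \<longlonglongrightarrow> u x" if x: "x \<in> C" for x
  proof (rule LIMSEQ_I)
    fix e :: real assume e: "0 < e"
    have "\<forall>\<^sub>F k in sequentially. \<forall>y\<in>C. dist (cesaro f (r k) y) (u y) < e / 2"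
      using e finite_C by (intro eventually_ball_finite ballI tendstoD[OF u]) auto
    moreover have "\<forall>\<^sub>F k in sequentially. r k > 0"
      using eventually_gt_at_top[of 0] by eventually_elim (use seq_suble[OF r] in \<open>auto intro: less_le_trans\<close>)
    ultimately have "\<forall>\<^sub>F k in sequentially. (\<forall>y\<in>C. dist (cesaro f (r k) y) (u y) < e / 2) \<and> r k > 0"
      by (rule eventually_conj)
    \<comment> \<open>\<open>T\<close> is a positive index of the subsequence at which the average
      is within \<open>e / 2\<close> of \<open>u\<close> at all states simultaneously.\<close>
    from eventually_happens'[OF sequentially_bot this]
    obtain T where T: "T > 0" "\<And>y. y \<in> C \<Longrightarrow> \<bar>cesaro f T y - u y\<bar> < e / 2"
      by (auto simp: dist_real_def)
    define h where "h = potential f T"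
    have "eventually (\<lambda>N. \<bar>(h x - (P ^^ N) h x) / real N\<bar> < e / 2) sequentially"
      using tendstoD[OF vanish[OF x, of h], of "e / 2"] e by (simp add: dist_real_def)
    then obtain N0 where N0: "\<And>N. N \<ge> N0 \<Longrightarrow> \<bar>(h x - (P ^^ N) h x) / real N\<bar> < e / 2"
      by (auto simp: eventually_sequentially)
    \<comment> \<open>\<open>Suc N0\<close> keeps \<open>N\<close> positive, so that averaging the
      constant \<open>u x\<close> returns \<open>u x\<close>.\<close>
    have "norm (cesaro f N x - u x) < e" if N: "N \<ge> Suc N0" for N
    proof -
      \<comment> \<open>On \<open>C\<close>, \<open>f\<close> splits into the invariant
        \<open>u\<close>, the coboundary \<open>h - P h\<close> and the remainder
        \<open>cesaro f T - u\<close>, which is smaller than \<open>e / 2\<close> and stays so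
        bounded under every iterate.\<close>
      have "(P ^^ k) f x = u x + (P ^^ k) (\<lambda>y. h y - P h y) x + (P ^^ k) (\<lambda>y. cesaro f T y - u y) x" for k
      proof -
        have "(P ^^ k) f x
            = (P ^^ k) (\<lambda>y. (u y + (h y - P h y)) + (cesaro f T y - u y)) x"
          using potential_equation[OF _ T(1), of _ f] x unfolding h_def by (intro iter_cong) auto
        then show ?thesis
          using x iter_invariant[OF inv] by (simp only: iter_add)
      qed
      then have "cesaro f N x = u x + cesaro (\<lambda>y. h y - P h y) N x + cesaro (\<lambda>y. cesaro f T y - u y) N x"
        using N by (simp add: cesaro_def sum.distrib add_divide_distrib)
      moreover have "\<bar>cesaro (\<lambda>y. cesaro f T y - u y) N x\<bar> \<le> e / 2"
        using T x e by (intro abs_cesaro_le) (auto intro: less_imp_le)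
      moreover have "\<bar>cesaro (\<lambda>y. h y - P h y) N x\<bar> < e / 2"
        using N0[of N] N by (simp only: cesaro_coboundary[OF x] Suc_leD)
      ultimately show ?thesis
        unfolding real_norm_def by linarith
    qed
    then show "\<exists>no. \<forall>n\<ge>no. norm (cesaro f n x - u x) < e" by blast
  qed
  with inv show ?thesis by blast
qed

section \<open>Laws of the chain and the stationary distribution\<close>

lemma chain_law_subset: "set_pmf \<mu> \<subseteq> C \<Longrightarrow> set_pmf (chain_law Q \<mu> t) \<subseteq> C"
  by (induction t) (use closed in auto)

lemma expectation_bind:
  assumes "set_pmf \<mu> \<subseteq> C"
  shows "measure_pmf.expectation (bind_pmf \<mu> Q) f = measure_pmf.expectation \<mu> (P f)"
proof -
  have "measure_pmf.expectation (bind_pmf \<mu> Q) f = (\<Sum>x\<in>C. pmf \<mu> x *\<^sub>R measure_pmf.expectation (Q x) f)"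
    using finite_C closed assms by (intro pmf_expectation_bind) (auto intro: finite_subset)
  then show ?thesis
    using assms by (simp add: expectation_eq_sum[OF assms] P_def mult.commute)
qed

text \<open>Each step of the kernel moves from the law onto the function, hence \<open>f\<close> is
  arbitrary in the induction.\<close>

lemma expectation_chain_law:
  assumes "set_pmf \<mu> \<subseteq> C"
  shows "measure_pmf.expectation (chain_law Q \<mu> t) f = measure_pmf.expectation \<mu> ((P ^^ t) f)"
proof (induction t arbitrary: f)
  case (Suc t)
  show ?case
    using expectation_bind[OF chain_law_subset[OF assms, of t]] Suc by (simp add: funpow_swap1)
qed simp

text \<open>The averaged expectations are mixtures of \<open>cesaro f N x\<close> with the fixed
  finite weights \<open>pmf \<mu> x\<close>.\<close>

lemma chain_law_average_tendsto:
  assumes "set_pmf \<mu> \<subseteq> C" and "\<And>x. x \<in> C \<Longrightarrow> (\<lambda>N. cesaro f N x) \<longlonglongrightarrow> u x"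
  shows "(\<lambda>N. (\<Sum>t<N. measure_pmf.expectation (chain_law Q \<mu> t) f) / real N)
           \<longlonglongrightarrow> measure_pmf.expectation \<mu> u"
proof -
  have "(\<Sum>t<N. measure_pmf.expectation (chain_law Q \<mu> t) f) / real N
      = (\<Sum>x\<in>C. cesaro f N x * pmf \<mu> x)" for N
    by (simp add: expectation_chain_law[OF assms(1)] expectation_eq_sum[OF assms(1)] cesaro_def
        sum_divide_distrib sum_distrib_right sum.swap[of _ C "{..<N}"])
  moreover have "(\<lambda>N. \<Sum>x\<in>C. cesaro f N x * pmf \<mu> x) \<longlonglongrightarrow> (\<Sum>x\<in>C. u x * pmf \<mu> x)"
    by (intro tendsto_sum tendsto_mult_right assms)
  ultimately show ?thesis
    by (simp add: expectation_eq_sum[OF assms(1)])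
qed

text \<open>Maximum principle: the value at a maximiser is a mean over the states reached after
  \<open>k\<close> steps, so every state reached with positive probability attains the maximum
  too.\<close>

lemma invariant_constant:
  assumes irr: "\<And>x y. x \<in> C \<Longrightarrow> y \<in> C \<Longrightarrow> \<exists>k. pmf (chain_law Q (return_pmf x) k) y > 0"
    and inv: "\<And>x. x \<in> C \<Longrightarrow> P u x = u x"
    and xy: "x \<in> C" "y \<in> C"
  shows "u x = u y"
proof -
  define m where "m = Max (u ` C)"
  have le: "u z \<le> m" if "z \<in> C" for z
    using that finite_C by (auto simp: m_def)
  obtain z where z: "z \<in> C" "u z = m"
    using Max_in[of "u ` C"] finite_C xy(1) unfolding m_def by (metis empty_iff finite_imageI imageE image_eqI)
  have "u y = m" if y: "y \<in> C" for y
  proof -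
    obtain k where k: "pmf (chain_law Q (return_pmf z) k) y > 0"
      using irr z y by blast
    let ?\<nu> = "chain_law Q (return_pmf z) k"
    have sub: "set_pmf ?\<nu> \<subseteq> C"
      using z by (intro chain_law_subset) auto
    have "measure_pmf.expectation ?\<nu> u = m"
      using z iter_invariant[OF inv] by (simp add: expectation_chain_law)
    then have "(\<Sum>x\<in>C. (m - u x) * pmf ?\<nu> x) = 0"
      using sum_pmf_C[OF sub]
      by (simp add: expectation_eq_sum[OF sub] left_diff_distrib sum_subtractf flip: sum_distrib_left)
    then have "(m - u y) * pmf ?\<nu> y = 0"
      using le y finite_C by (subst (asm) sum_nonneg_eq_0_iff) auto
    then show ?thesis using k by simp
  qed
  then show ?thesis using xy by metis
qed

text \<open>The limit is an invariant function, hence constant. Starting the chain from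
  \<open>\<pi>\<close> identifies the constant, since all laws then equal
  \<open>\<pi>\<close>.\<close>

theorem irreducible_mean_ergodic:
  assumes irr: "\<And>x y. x \<in> C \<Longrightarrow> y \<in> C \<Longrightarrow> \<exists>k. pmf (chain_law Q (return_pmf x) k) y > 0"
    and \<pi>: "set_pmf \<pi> \<subseteq> C" "bind_pmf \<pi> Q = \<pi>" and x: "x \<in> C"
  shows "(\<lambda>N. cesaro f N x) \<longlonglongrightarrow> measure_pmf.expectation \<pi> f"
proof -
  obtain u where inv: "\<And>x. x \<in> C \<Longrightarrow> P u x = u x"
    and u: "\<And>x. x \<in> C \<Longrightarrow> (\<lambda>N. cesaro f N x) \<longlonglongrightarrow> u x"
    using mean_ergodic by blast
  have "chain_law Q \<pi> t = \<pi>" for t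
    by (induction t) (simp_all add: \<pi>)
  then have lim: "(\<lambda>N. (\<Sum>t<N. measure_pmf.expectation \<pi> f) / real N) \<longlonglongrightarrow> measure_pmf.expectation \<pi> u"
    using chain_law_average_tendsto[OF \<pi>(1) u] by simp
  have eq: "\<forall>\<^sub>F N in sequentially. (\<Sum>t<N. measure_pmf.expectation \<pi> f) / real N
      = measure_pmf.expectation \<pi> f"
    using eventually_gt_at_top[of 0] by eventually_elim simp
  have "measure_pmf.expectation \<pi> f = measure_pmf.expectation \<pi> u"
    by (rule LIMSEQ_unique[OF tendsto_eventually[OF eq] lim])
  also have "\<dots> = (\<Sum>y\<in>C. u x * pmf \<pi> y)"
    unfolding expectation_eq_sum[OF \<pi>(1)]
    by (rule sum.cong) (simp_all only: invariant_constant[OF irr inv _ x])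
  also have "\<dots> = u x"
    using sum_pmf_C[OF \<pi>(1)] by (simp flip: sum_distrib_left)
  finally show ?thesis
    using u x by simp
qed

end

section \<open>Fair policies\<close>

text \<open>\<open>time_avg\<close> divides \<open>T + 1\<close> summands by \<open>T\<close>; the
  correcting factor \<open>(T + 1) / T\<close> tends to 1.\<close>

lemma time_avg_tendsto:
  assumes "(\<lambda>N. (\<Sum>t<N. F t) / real N) \<longlonglongrightarrow> L"
  shows "time_avg F \<longlonglongrightarrow> L"
proof -
  have "(\<lambda>T. (\<Sum>t<Suc T. F t) / real (Suc T) * (real (Suc T) / real T)) \<longlonglongrightarrow> L * 1"
    by (intro tendsto_mult LIMSEQ_Suc assms LIMSEQ_Suc_n_over_n)
  moreover have "(\<Sum>t<Suc T. F t) / real (Suc T) * (real (Suc T) / real T) = time_avg F T" for T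
    by (simp only: time_avg_def atLeast0AtMost lessThan_Suc_atMost) simp
  ultimately show ?thesis by simp
qed

lemma time_avg_mono: "(\<And>t. f t \<le> g t) \<Longrightarrow> time_avg f T \<le> time_avg g T"
  unfolding time_avg_def by (intro mult_left_mono sum_mono) auto

lemma time_avg_nonneg: "(\<And>t. 0 \<le> f t) \<Longrightarrow> 0 \<le> time_avg f T"
  unfolding time_avg_def by (intro mult_nonneg_nonneg sum_nonneg) auto

lemma time_avg_diff: "time_avg (\<lambda>t. f t - g t) T = time_avg f T - time_avg g T"
  by (simp add: time_avg_def sum_subtractf algebra_simps)

text \<open>Policies are constrained only at states in \<open>S\<close> with levels in range; the
  induction shows that the process never leaves these.\<close>

lemma step_law_support:
  assumes "p \<in> policies S bmax" and "set_pmf \<mu> \<subseteq> S \<times> {0..int bmax}"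
    and "\<And>x. x \<in> S \<Longrightarrow> set_pmf (K x) \<subseteq> S"
    and "(h, x, b, a) \<in> set_pmf (step_law K \<mu> p t)"
  shows "x \<in> S" and "b \<in> {0..int bmax}" and "a \<in> allowable bmax x b"
proof -
  have state: "x \<in> S \<and> b \<in> {0..int bmax}" if "(h, x, b) \<in> set_pmf (state_law K \<mu> p t)" for h x b t
    using that
  proof (induction t arbitrary: h x b)
    case 0
    then show ?case using assms(2) by auto
  next
    case (Suc t)
    then obtain h' x' b' a where prev: "(h', x', b') \<in> set_pmf (state_law K \<mu> p t)"
      and a: "a \<in> set_pmf (p h' x' b')" and x: "x \<in> set_pmf (K x')" and b: "b = b' + (\<Sum>i\<in>UNIV. a i)"
      by (auto simp: choose_action_def)
    have "a \<in> allowable bmax x' b'"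
      using Suc.IH[OF prev] a assms(1) unfolding policies_def by blast
    then show ?case
      using Suc.IH[OF prev] x assms(3) b unfolding allowable_def by auto
  qed
  obtain "(h, x, b) \<in> set_pmf (state_law K \<mu> p t)" "a \<in> set_pmf (p h x b)"
    using assms(4) by (auto simp: step_law_def choose_action_def)
  with state assms(1) show "x \<in> S" "b \<in> {0..int bmax}" "a \<in> allowable bmax x b"
    unfolding policies_def by blast+
qed

text \<open>Actions enter only the history and the level, so projecting onto the net generation
  leaves the autonomous chain.\<close>

lemma map_step_law_generation:
  "map_pmf (\<lambda>(h, x, b, a). x) (step_law K \<mu> p t) = chain_law K (map_pmf fst \<mu>) t"
proof -
  have step: "map_pmf (\<lambda>(h, x, b, a). x) (choose_action p \<nu>) = map_pmf (\<lambda>(h, x, b). x) \<nu>" for \<nu>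
    by (simp add: choose_action_def map_bind_pmf map_pmf_comp case_prod_unfold flip: map_pmf_def)
  have "map_pmf (\<lambda>(h, x, b). x) (state_law K \<mu> p t) = chain_law K (map_pmf fst \<mu>) t"
  proof (induction t)
    case 0
    show ?case by (simp add: map_pmf_comp case_prod_unfold)
  next
    case (Suc t)
    have "map_pmf (\<lambda>(h, x, b). x) (state_law K \<mu> p (Suc t))
        = bind_pmf (map_pmf (\<lambda>(h, x, b, a). x) (choose_action p (state_law K \<mu> p t))) K"
      by (simp add: map_bind_pmf bind_map_pmf map_pmf_comp case_prod_unfold)
    then show ?case
      by (simp only: step Suc) simp
  qed
  then show ?thesis
    by (simp add: step_law_def step)
qed

section \<open>Loss bounds for arbitrary policies\<close>

locale battery_sharing = finite_chain S K
  for S :: "'n::finite energy set" and K :: "'n kernel" +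
  fixes \<pi> :: "'n energy pmf"
  assumes irreducible: "irreducible_chain S K"
    and stationary: "stationary S K \<pi>"
begin

text \<open>A crude bound, uniform over \<open>S\<close>, on the total net generation and on every
  action. It also serves as the threshold of the policy used for the upper bound.\<close>

definition M :: int where
  "M = (\<Sum>x\<in>S. \<Sum>i\<in>UNIV. \<bar>x i\<bar>)"

lemma sum_abs_le_M: "x \<in> S \<Longrightarrow> (\<Sum>i\<in>UNIV. \<bar>x i\<bar>) \<le> M"
  unfolding M_def using finite_C by (intro member_le_sum[where f = "\<lambda>x. \<Sum>i\<in>UNIV. \<bar>x i\<bar>"]) (auto intro: sum_nonneg)

lemma abs_le_M: "x \<in> S \<Longrightarrow> \<bar>x i\<bar> \<le> M"
  using sum_abs_le_M[of x] member_le_sum[of i UNIV "\<lambda>i. \<bar>x i\<bar>"] by simp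

lemma M_nonneg: "0 \<le> M"
  unfolding M_def by (intro sum_nonneg) auto

lemma cesaro_tendsto:
  "x \<in> S \<Longrightarrow> (\<lambda>N. cesaro f N x) \<longlonglongrightarrow> measure_pmf.expectation \<pi> f"
  using irreducible stationary
  by (intro irreducible_mean_ergodic)
    (auto simp: irreducible_chain_def kernel_iter_def stationary_def)

lemma drift_eq_expectation: "drift S \<pi> i = measure_pmf.expectation \<pi> (\<lambda>x. real_of_int (x i))"
  using stationary by (simp add: drift_def stationary_def expectation_eq_sum)

lemma abs_action_le_M:
  assumes "x \<in> S" "a \<in> allowable bmax x b"
  shows "\<bar>a i\<bar> \<le> M"
proof -
  have "if 0 \<le> x i then a i \<in> {0..x i} else a i \<in> {x i..0}"
    using assms(2) unfolding allowable_def by blast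
  then show ?thesis
    using abs_le_M[OF assms(1), of i] by (auto split: if_splits)
qed

text \<open>In a deficit the loss is exactly \<open>a i - x i\<close>; otherwise it is 0, while
  \<open>a i \<le> x i\<close>.\<close>

lemma loss_nonneg:
  assumes "a \<in> allowable bmax x b"
  shows "0 \<le> (if x i < 0 then real_of_int (a i - x i) else 0)"
    and "real_of_int (a i) - real_of_int (x i) \<le> (if x i < 0 then real_of_int (a i - x i) else 0)"
proof -
  have "if 0 \<le> x i then a i \<in> {0..x i} else a i \<in> {x i..0}"
    using assms unfolding allowable_def by blast
  then show "0 \<le> (if x i < 0 then real_of_int (a i - x i) else 0)"
    and "real_of_int (a i) - real_of_int (x i) \<le> (if x i < 0 then real_of_int (a i - x i) else 0)"
    by (auto split: if_splits)
qed

text \<open>Both are integrated forms of \<open>loss_nonneg\<close>. The mean of \<open>x i\<close>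
  is that of the autonomous chain, so it is the same for all policies.\<close>

lemma mean_loss_bounds:
  assumes p: "p \<in> policies S bmax" and \<mu>: "set_pmf \<mu> \<subseteq> S \<times> {0..int bmax}"
  shows "0 \<le> mean_loss K \<mu> p i t"
    and "mean_action K \<mu> p i t
           - measure_pmf.expectation (chain_law K (map_pmf fst \<mu>) t) (\<lambda>x. real_of_int (x i))
         \<le> mean_loss K \<mu> p i t"
proof -
  let ?law = "step_law K \<mu> p t"
  let ?loss = "\<lambda>(h, x, b, a). if x i < 0 then real_of_int (a i - x i) else 0"
  let ?act = "\<lambda>(h, x, b, a). real_of_int (a i)"
  let ?gen = "\<lambda>(h, x, b, a). real_of_int (x i)"
  have supp: "x \<in> S" "a \<in> allowable bmax x b" if "(h, x, b, a) \<in> set_pmf ?law" for h x b a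
    using step_law_support[OF p \<mu> closed that] by auto
  show "0 \<le> mean_loss K \<mu> p i t"
    unfolding mean_loss_def using loss_nonneg(1)[OF supp(2)]
    by (intro integral_nonneg_AE) (auto simp: AE_measure_pmf_iff)
  have act: "integrable ?law ?act"
    using abs_action_le_M[OF supp(1) supp(2)]
    by (intro measure_pmf.integrable_const_bound[where B = "real_of_int M"])
      (auto simp: AE_measure_pmf_iff simp flip: of_int_abs)
  have gen: "integrable ?law ?gen"
    using abs_le_M[OF supp(1)]
    by (intro measure_pmf.integrable_const_bound[where B = "real_of_int M"])
      (auto simp: AE_measure_pmf_iff simp flip: of_int_abs)
  have loss: "integrable ?law ?loss"
  proof (rule measure_pmf.integrable_const_bound[where B = "real_of_int (2 * M)"])
    have "norm (?loss z) \<le> real_of_int (2 * M)" if "z \<in> set_pmf ?law" for z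
    proof -
      obtain h x b a where z: "z = (h, x, b, a)" by (cases z)
      have "\<bar>a i\<bar> \<le> M" "\<bar>x i\<bar> \<le> M"
        using that abs_action_le_M abs_le_M supp unfolding z by blast+
      then show ?thesis by (auto simp: z abs_le_iff)
    qed
    then show "AE z in ?law. norm (?loss z) \<le> real_of_int (2 * M)"
      by (simp add: AE_measure_pmf_iff)
  qed simp
  have "measure_pmf.expectation (chain_law K (map_pmf fst \<mu>) t) (\<lambda>x. real_of_int (x i))
      = measure_pmf.expectation ?law ?gen"
    unfolding map_step_law_generation[of K \<mu> p t, symmetric] integral_map_pmf
    by (simp add: case_prod_unfold)
  moreover have "measure_pmf.expectation ?law (\<lambda>z. ?act z - ?gen z) \<le> measure_pmf.expectation ?law ?loss"
    using loss_nonneg(2)[OF supp(2)]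
    by (intro integral_mono_AE Bochner_Integration.integrable_diff act gen loss)
      (auto simp: AE_measure_pmf_iff)
  ultimately show "mean_action K \<mu> p i t
           - measure_pmf.expectation (chain_law K (map_pmf fst \<mu>) t) (\<lambda>x. real_of_int (x i))
         \<le> mean_loss K \<mu> p i t"
    using Bochner_Integration.integral_diff[OF act gen]
    by (simp add: mean_loss_def mean_action_def)
qed

lemma LLR_nonneg:
  assumes "p \<in> policies S bmax" "set_pmf \<mu> \<subseteq> S \<times> {0..int bmax}" "LLR_defined K \<mu> p"
  shows "0 \<le> LLR K \<mu> p i"
  unfolding LLR_def
proof (rule LIMSEQ_le_const)
  show "time_avg (mean_loss K \<mu> p i) \<longlonglongrightarrow> lim (time_avg (mean_loss K \<mu> p i))"
    using assms(3) by (simp add: LLR_defined_def convergent_LIMSEQ_iff)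
  show "\<exists>N. \<forall>n\<ge>N. 0 \<le> time_avg (mean_loss K \<mu> p i) n"
    using mean_loss_bounds(1)[OF assms(1,2)] by (blast intro: time_avg_nonneg)
qed

text \<open>In the time-averaged bound of user \<open>i\<close>, the accepted energy has a
  nonnegative limit by fairness and the net generation tends to the drift. The losses of the other
  users are nonnegative.\<close>

lemma fair_LLR_sys_ge:
  assumes p: "p \<in> policies S bmax" and \<mu>: "set_pmf \<mu> \<subseteq> S \<times> {0..int bmax}"
    and def: "LLR_defined K \<mu> p" and fair: "fair K \<mu> p"
  shows "- drift S \<pi> i \<le> LLR_sys K \<mu> p"
proof -
  let ?X = "\<lambda>t. measure_pmf.expectation (chain_law K (map_pmf fst \<mu>) t) (\<lambda>x. real_of_int (x i))"
  have "set_pmf (map_pmf fst \<mu>) \<subseteq> S"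
    using \<mu> by auto
  then have "(\<lambda>N. (\<Sum>t<N. ?X t) / real N)
      \<longlonglongrightarrow> measure_pmf.expectation (map_pmf fst \<mu>) (\<lambda>_. drift S \<pi> i)"
    by (rule chain_law_average_tendsto) (simp add: cesaro_tendsto drift_eq_expectation)
  then have X: "time_avg ?X \<longlonglongrightarrow> drift S \<pi> i"
    by (intro time_avg_tendsto) simp
  have A: "time_avg (mean_action K \<mu> p i) \<longlonglongrightarrow> lim (time_avg (mean_action K \<mu> p i))"
    using fair by (simp add: fair_def convergent_LIMSEQ_iff)
  have L: "time_avg (mean_loss K \<mu> p i) \<longlonglongrightarrow> LLR K \<mu> p i"
    using def by (simp add: LLR_defined_def LLR_def convergent_LIMSEQ_iff)
  have "lim (time_avg (mean_action K \<mu> p i)) - drift S \<pi> i \<le> LLR K \<mu> p i"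
  proof (rule LIMSEQ_le[OF tendsto_diff[OF A X] L], intro exI[of _ 0] allI impI)
    fix T
    show "time_avg (mean_action K \<mu> p i) T - time_avg ?X T \<le> time_avg (mean_loss K \<mu> p i) T"
      unfolding time_avg_diff[symmetric] by (intro time_avg_mono mean_loss_bounds(2)[OF p \<mu>])
  qed
  moreover have "0 \<le> lim (time_avg (mean_action K \<mu> p i))"
    using fair by (simp add: fair_def)
  moreover have "LLR K \<mu> p i \<le> LLR_sys K \<mu> p"
    unfolding LLR_sys_def using LLR_nonneg[OF p \<mu> def] by (intro member_le_sum) auto
  ultimately show ?thesis by linarith
qed

end

section \<open>The unfair optimum\<close>

text \<open>A suboptimal policy that is easy to analyse: surplus that does not fit as a whole is refused
  as a whole.  The kernel is that of the pair of net generation and battery level under it.\<close>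

definition threshold_action :: "int \<Rightarrow> nat \<Rightarrow> 'n::finite energy \<Rightarrow> int \<Rightarrow> 'n energy" where
  "threshold_action m bmax x b =
     (if b < m then (\<lambda>i. max 0 (x i))
      else if b + (\<Sum>i\<in>UNIV. x i) \<le> int bmax then x
      else (\<lambda>i. min 0 (x i)))"

definition threshold_kernel ::
  "'n::finite kernel \<Rightarrow> int \<Rightarrow> nat \<Rightarrow> 'n energy \<times> int \<Rightarrow> ('n energy \<times> int) pmf" where
  "threshold_kernel K m bmax =
     (\<lambda>(x, b). map_pmf (\<lambda>x'. (x', b + (\<Sum>i\<in>UNIV. threshold_action m bmax x b i))) (K x))"

definition threshold_policy :: "int \<Rightarrow> nat \<Rightarrow> 'n::finite policy" where
  "threshold_policy m bmax h x b = return_pmf (threshold_action m bmax x b)"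

text \<open>All parts follow from the total surplus \<open>s\<close> and the total deficit
  \<open>d\<close>, with \<open>s - d \<le> m\<close>. Below \<open>m\<close> there is room for all
  surplus, from \<open>m\<close> on there is enough for all demand, and surplus is refused only if
  \<open>b + (s + d)\<close> exceeds \<open>bmax\<close>.\<close>

lemma threshold_action:
  fixes x :: "'n::finite energy"
  assumes x: "(\<Sum>i\<in>UNIV. \<bar>x i\<bar>) \<le> m" and b: "b \<in> {0..int bmax}" and m: "2 * m \<le> int bmax"
  defines "a \<equiv> threshold_action m bmax x b"
  shows threshold_action_allowable: "a \<in> allowable bmax x b"
    and threshold_action_abs: "\<bar>\<Sum>i\<in>UNIV. a i\<bar> \<le> m"
    and threshold_action_charge: "(\<Sum>i\<in>UNIV. x i) \<le> (\<Sum>i\<in>UNIV. a i) \<or> int bmax - m < b"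
    and threshold_action_serves: "m \<le> b \<Longrightarrow> x i < 0 \<Longrightarrow> a i = x i"
    and threshold_action_loss: "(\<Sum>i\<in>UNIV. if x i < 0 then a i - x i else 0) \<le> m"
proof -
  define s where "s = (\<Sum>i\<in>UNIV. max 0 (x i))"
  define d where "d = (\<Sum>i\<in>UNIV. min 0 (x i))"
  have sum_x: "(\<Sum>i\<in>UNIV. x i) = s + d"
    unfolding s_def d_def sum.distrib[symmetric] by (intro sum.cong) auto
  have "(\<Sum>i\<in>UNIV. \<bar>x i\<bar>) = s - d"
    unfolding s_def d_def sum_subtractf[symmetric] by (intro sum.cong) auto
  with x have sd: "s - d \<le> m" by simp
  have s: "0 \<le> s" and d: "d \<le> 0"
    unfolding s_def d_def by (auto intro: sum_nonneg sum_nonpos)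
  have sum_a: "(\<Sum>i\<in>UNIV. a i) = (if b < m then s else if b + (s + d) \<le> int bmax then s + d else d)"
    unfolding a_def threshold_action_def s_def d_def using sum_x s_def d_def by auto
  show "a \<in> allowable bmax x b"
    unfolding allowable_def mem_Collect_eq sum_a using b m sd s d
    by (auto simp: a_def threshold_action_def)
  show "\<bar>\<Sum>i\<in>UNIV. a i\<bar> \<le> m"
    unfolding sum_a using sd s d by auto
  show "(\<Sum>i\<in>UNIV. x i) \<le> (\<Sum>i\<in>UNIV. a i) \<or> int bmax - m < b"
    unfolding sum_a sum_x using sd s d by auto
  show "m \<le> b \<Longrightarrow> x i < 0 \<Longrightarrow> a i = x i"
    by (auto simp: a_def threshold_action_def)
  have "(\<Sum>i\<in>UNIV. if x i < 0 then a i - x i else 0) \<le> (\<Sum>i\<in>UNIV. \<bar>x i\<bar>)"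
    by (intro sum_mono) (auto simp: a_def threshold_action_def)
  then show "(\<Sum>i\<in>UNIV. if x i < 0 then a i - x i else 0) \<le> m"
    using x by simp
qed

text \<open>The policy ignores the history, so the pair of net generation and level is itself a
  Markov chain.\<close>

lemma map_state_law_threshold:
  "map_pmf snd (state_law K \<mu> (threshold_policy m bmax) t)
     = chain_law (threshold_kernel K m bmax) \<mu> t"
proof (induction t)
  case 0
  show ?case by (simp add: map_pmf_comp case_prod_unfold)
next
  case (Suc t)
  have "map_pmf snd (state_law K \<mu> (threshold_policy m bmax) (Suc t))
      = bind_pmf (map_pmf snd (state_law K \<mu> (threshold_policy m bmax) t)) (threshold_kernel K m bmax)"
    by (simp add: choose_action_def threshold_policy_def threshold_kernel_def map_bind_pmf
        bind_map_pmf bind_assoc_pmf bind_return_pmf map_pmf_comp case_prod_unfold)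
  then show ?case
    by (simp only: Suc) simp
qed

lemma mean_loss_threshold:
  "mean_loss K \<mu> (threshold_policy m bmax) i t
     = measure_pmf.expectation (chain_law (threshold_kernel K m bmax) \<mu> t)
         (\<lambda>(x, b). if x i < 0 then real_of_int (threshold_action m bmax x b i - x i) else 0)"
proof -
  have "step_law K \<mu> (threshold_policy m bmax) t
      = map_pmf (\<lambda>(h, x, b). (h, x, b, threshold_action m bmax x b))
          (state_law K \<mu> (threshold_policy m bmax) t)"
    by (simp add: step_law_def choose_action_def threshold_policy_def case_prod_unfold
        flip: map_pmf_def)
  then show ?thesis
    unfolding mean_loss_def map_state_law_threshold[symmetric]
    by (simp add: case_prod_unfold cong: if_cong)
qed

section \<open>Loss rate of the threshold policy\<close>

context battery_sharing
begin

lemma finite_chain_threshold: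
  assumes "2 * M \<le> int bmax"
  shows "finite_chain (S \<times> {0..int bmax}) (threshold_kernel K M bmax)"
proof
  show "finite (S \<times> {0..int bmax})"
    using finite_C by simp
  fix z assume "z \<in> S \<times> {0..int bmax}"
  then obtain x b where z: "z = (x, b)" "x \<in> S" "b \<in> {0..int bmax}"
    by blast
  have "b + (\<Sum>i\<in>UNIV. threshold_action M bmax x b i) \<in> {0..int bmax}"
    using threshold_action_allowable[OF sum_abs_le_M[OF z(2)] z(3) assms]
    by (simp add: allowable_def)
  then show "set_pmf (threshold_kernel K M bmax z) \<subseteq> S \<times> {0..int bmax}"
    using closed[OF z(2)] by (auto simp: threshold_kernel_def z(1))
qed

lemma threshold_policy_policies:
  assumes "2 * M \<le> int bmax"
  shows "threshold_policy M bmax \<in> policies S bmax"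
  using threshold_action_allowable[OF sum_abs_le_M _ assms]
  by (auto simp: policies_def threshold_policy_def)

text \<open>The mean loss is the expectation of a fixed function of the pair chain, whose averages
  converge by \<open>mean_ergodic\<close>, to a limit that may depend on the initial state.\<close>

lemma LLR_defined_threshold:
  assumes bmax: "2 * M \<le> int bmax" and \<mu>: "set_pmf \<mu> \<subseteq> S \<times> {0..int bmax}"
  shows "LLR_defined K \<mu> (threshold_policy M bmax)"
  unfolding LLR_defined_def
proof
  fix i
  interpret B: finite_chain "S \<times> {0..int bmax}" "threshold_kernel K M bmax"
    using bmax by (rule finite_chain_threshold)
  obtain u where "\<And>z. z \<in> S \<times> {0..int bmax} \<Longrightarrow>
      (\<lambda>N. B.cesaro (\<lambda>(x, b). if x i < 0 then real_of_int (threshold_action M bmax x b i - x i) else 0) N z)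
        \<longlonglongrightarrow> u z"
    using B.mean_ergodic by blast
  from time_avg_tendsto[OF B.chain_law_average_tendsto[OF \<mu> this]]
  show "convergent (time_avg (mean_loss K \<mu> (threshold_policy M bmax) i))"
    unfolding mean_loss_threshold[abs_def] by (rule convergentI)
qed

text \<open>\<open>h\<close> is the potential of the total net generation at a horizon
  \<open>N\<close> so long that the Cesaro average exceeds \<open>\<delta>\<close> at every state;
  finiteness of \<open>S\<close> makes one \<open>N\<close> suffice.\<close>

lemma positive_drift_potential:
  assumes "(\<Sum>i\<in>UNIV. drift S \<pi> i) > 0"
  obtains h \<delta> where "\<delta> > 0"
    and "\<And>x. x \<in> S \<Longrightarrow> h x + \<delta> \<le> P h x + real_of_int (\<Sum>i\<in>UNIV. x i)"
proof -
  let ?f = "\<lambda>x :: 'n energy. real_of_int (\<Sum>i\<in>UNIV. x i)"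
  \<comment> \<open>Half the system drift, leaving a margin below the limit
    \<open>2 * \<delta>\<close> of the averages.\<close>
  define \<delta> where "\<delta> = (\<Sum>i\<in>UNIV. drift S \<pi> i) / 2"
  have sub: "set_pmf \<pi> \<subseteq> S"
    using stationary by (simp add: stationary_def)
  have "measure_pmf.expectation \<pi> ?f = (\<Sum>i\<in>UNIV. drift S \<pi> i)"
    by (simp add: expectation_eq_sum[OF sub] drift_def sum_distrib_right sum.swap[of _ UNIV S])
  then have lim: "(\<lambda>N. cesaro ?f N x) \<longlonglongrightarrow> 2 * \<delta>" if "x \<in> S" for x
    using cesaro_tendsto[OF that, of ?f] by (simp add: \<delta>_def)
  have \<delta>: "\<delta> > 0"
    using assms by (simp add: \<delta>_def)
  have "\<forall>\<^sub>F N in sequentially. \<forall>x\<in>S. \<delta> < cesaro ?f N x"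
    using finite_C \<delta> by (intro eventually_ball_finite ballI order_tendstoD(1)[OF lim]) auto
  from eventually_happens'[OF sequentially_bot eventually_conj[OF this eventually_gt_at_top[of 0]]]
  obtain N where N: "N > 0" "\<And>x. x \<in> S \<Longrightarrow> \<delta> < cesaro ?f N x"
    by blast
  show thesis
  proof (rule that[OF \<delta>])
    fix x assume x: "x \<in> S"
    show "potential ?f N x + \<delta> \<le> P (potential ?f N) x + ?f x"
      using potential_equation[OF x N(1), of ?f] N(2)[OF x] by linarith
  qed
qed

text \<open>By the potential \<open>h\<close>, the level \<open>b + h x\<close> increases by at least \<open>\<delta>\<close> on average, except when
  surplus is refused, and then \<open>b\<close> is close to \<open>bmax\<close>.  So the square of the corrected headroom
  \<open>g\<close> has drift at most \<open>C - 2 \<delta> g\<close>, which bounds the long-run mean of \<open>g\<close> independently of \<open>bmax\<close>.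
  Unserved demand requires \<open>b < M\<close>, where \<open>g\<close> is at least \<open>bmax - M\<close>.\<close>

lemma LLR_sys_threshold_le:
  fixes h :: "'n energy \<Rightarrow> real" and \<delta> H C :: real
  assumes \<delta>: "\<delta> > 0"
    and h: "\<And>x. x \<in> S \<Longrightarrow> h x + \<delta> \<le> P h x + real_of_int (\<Sum>i\<in>UNIV. x i)"
    and H: "\<And>x. x \<in> S \<Longrightarrow> \<bar>h x\<bar> \<le> H"
    and bmax: "2 * M < int bmax" and \<mu>: "set_pmf \<mu> \<subseteq> S \<times> {0..int bmax}"
  defines "C \<equiv> (2 * H + M)\<^sup>2 + 4 * M * (M + 2 * H)"
  shows "LLR_sys K \<mu> (threshold_policy M bmax) \<le> M * C / (2 * \<delta> * (real bmax - M))"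
proof -
  let ?p = "threshold_policy M bmax"
  let ?D = "S \<times> {0..int bmax}"
  let ?law = "chain_law (threshold_kernel K M bmax) \<mu>"
  have bmax': "2 * M \<le> int bmax" using bmax by simp
  interpret B: finite_chain ?D "threshold_kernel K M bmax"
    using bmax' by (rule finite_chain_threshold)
  \<comment> \<open>Adding \<open>H\<close> makes \<open>g\<close> at least the headroom
    \<open>bmax - b\<close>, hence nonnegative.\<close>
  define g :: "'n energy \<times> int \<Rightarrow> real" where "g = (\<lambda>(x, b). real bmax - b - h x + H)"
  define loss :: "'n \<Rightarrow> 'n energy \<times> int \<Rightarrow> real" where
    "loss i = (\<lambda>(x, b). if x i < 0 then real_of_int (threshold_action M bmax x b i - x i) else 0)" for i
  have M: "0 \<le> real_of_int M" "real_of_int M < real bmax"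
    using M_nonneg bmax by linarith+
  have g_nonneg: "0 \<le> g z" if "z \<in> ?D" for z
    using that H by (force simp: g_def abs_le_iff)
  have drift: "B.P (\<lambda>z. (g z)\<^sup>2) z \<le> (g z)\<^sup>2 - 2 * \<delta> * g z + C" if zD: "z \<in> ?D" for z
  proof -
    obtain x b where z: "z = (x, b)" "x \<in> S" "b \<in> {0..int bmax}"
      using zD by blast
    define d where "d = (\<Sum>i\<in>UNIV. threshold_action M bmax x b i)"
    define s where "s = (\<Sum>i\<in>UNIV. x i)"
    \<comment> \<open>Bound on the change of \<open>g\<close> in one step: \<open>2 * H\<close> from
      the potential and \<open>M\<close> from the battery.\<close>
    define L :: real where "L = 2 * H + M"
    have g: "0 \<le> g z" using g_nonneg zD .
    have "\<bar>s\<bar> \<le> (\<Sum>i\<in>UNIV. \<bar>x i\<bar>)"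
      unfolding s_def by (rule sum_abs)
    then have s: "\<bar>s\<bar> \<le> M"
      using sum_abs_le_M[OF z(2)] by simp
    have d: "\<bar>d\<bar> \<le> M" "s \<le> d \<or> int bmax - M < b"
      unfolding d_def s_def
      using threshold_action_abs[OF sum_abs_le_M[OF z(2)] z(3) bmax']
        threshold_action_charge[OF sum_abs_le_M[OF z(2)] z(3) bmax']
      by simp_all
    have "B.P (\<lambda>z. (g z)\<^sup>2) z = P (\<lambda>x'. (g (x', b + d))\<^sup>2) x"
      unfolding B.P_def by (simp add: P_def threshold_kernel_def z(1) d_def)
    \<comment> \<open>The increment of \<open>g\<close> is \<open>e\<close>. Its square is bounded
      by a constant, but the cross term is kept exact in \<open>h x'\<close>, since its mean
      \<open>P h x\<close> carries the drift.\<close>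
    also have "\<dots> \<le> P (\<lambda>x'. ((g z)\<^sup>2 + 2 * g z * (h x - d) + L\<^sup>2) - 2 * g z * h x') x"
    proof (rule P_mono[OF _ z(2)])
      fix y assume y: "y \<in> S"
      define e where "e = h x - h y - d"
      have "\<bar>real_of_int d\<bar> \<le> real_of_int M"
        using d(1) by linarith
      then have "\<bar>e\<bar> \<le> L"
        using H[OF z(2)] H[OF y] unfolding e_def L_def by linarith
      then have "e\<^sup>2 \<le> L\<^sup>2"
        by (intro abs_le_square_iff[THEN iffD1]) simp
      moreover have "g (y, b + d) = g z + e"
        by (simp add: g_def z(1) e_def)
      then have "(g (y, b + d))\<^sup>2 = ((g z)\<^sup>2 + 2 * g z * (h x - d)) - 2 * g z * h y + e\<^sup>2"
        unfolding e_def by (simp only:) (simp add: power2_eq_square algebra_simps)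
      ultimately show "(g (y, b + d))\<^sup>2 \<le> ((g z)\<^sup>2 + 2 * g z * (h x - d) + L\<^sup>2) - 2 * g z * h y"
        by linarith
    qed
    also have "\<dots> = (g z)\<^sup>2 + 2 * g z * (h x - P h x - d) + L\<^sup>2"
      unfolding P_diff[OF z(2)] P_cmult[OF z(2)] P_const[OF z(2)] by (simp add: algebra_simps)
    also have "2 * g z * (h x - P h x - d) \<le> 2 * g z * (s - d - \<delta>)"
      using h[OF z(2)] g by (intro mult_left_mono) (auto simp: s_def)
    also have "2 * g z * (s - d - \<delta>) \<le> 4 * M * (M + 2 * H) - 2 * \<delta> * g z"
    proof -
      \<comment> \<open>Either at least the net generation is stored and the product is nonpositive,
        or the battery is nearly full and \<open>g z\<close> is bounded independently of
        \<open>bmax\<close>.\<close>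
      have "g z * (s - d) \<le> (M + 2 * H) * (2 * M)"
      proof (cases "s \<le> d")
        case True
        then have "g z * (s - d) \<le> 0"
          using g by (simp add: mult_nonneg_nonpos)
        moreover have "0 \<le> (M + 2 * H) * (2 * M)"
          using M H[OF z(2)] by (intro mult_nonneg_nonneg) auto
        ultimately show ?thesis by linarith
      next
        case False
        then have "real bmax - M < real_of_int b"
          using d(2) by linarith
        then have "g z \<le> M + 2 * H"
          using H[OF z(2)] by (simp add: g_def z(1) abs_le_iff)
        moreover have "real_of_int s - real_of_int d \<le> 2 * M"
          using s d(1) by linarith
        ultimately show ?thesis
          using False g by (intro mult_mono) auto
      qed
      then show ?thesis by (simp add: algebra_simps)
    qed
    finally show ?thesis
      by (simp add: C_def L_def)
  qed
  \<comment> \<open>Markov's inequality in pointwise form: a loss, at most \<open>M\<close> in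
    total, occurs only where \<open>g z \<ge> bmax - M\<close>.\<close>
  have loss_le: "(\<Sum>i\<in>UNIV. loss i z) \<le> M / (real bmax - M) * g z" if zD: "z \<in> ?D" for z
  proof -
    obtain x b where z: "z = (x, b)" "x \<in> S" "b \<in> {0..int bmax}"
      using zD by blast
    show ?thesis
    proof (cases "M \<le> b")
      case True
      then have "(\<Sum>i\<in>UNIV. loss i z) = 0"
        using threshold_action_serves[OF sum_abs_le_M[OF z(2)] z(3) bmax']
        by (auto simp: loss_def z(1) intro!: sum.neutral)
      then show ?thesis using g_nonneg[OF zD] M by simp
    next
      case False
      have "(\<Sum>i\<in>UNIV. loss i z)
          = real_of_int (\<Sum>i\<in>UNIV. if x i < 0 then threshold_action M bmax x b i - x i else 0)"
        by (auto simp: loss_def z(1) intro!: sum.cong)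
      also have "\<dots> \<le> M"
        using threshold_action_loss[OF sum_abs_le_M[OF z(2)] z(3) bmax'] by linarith
      also have "\<dots> = M / (real bmax - M) * (real bmax - M)"
        using M by simp
      also have "\<dots> \<le> M / (real bmax - M) * g z"
        using M False H[OF z(2)] by (intro mult_left_mono) (auto simp: g_def z(1) abs_le_iff)
      finally show ?thesis .
    qed
  qed
  define Eg where "Eg t = measure_pmf.expectation (?law t) g" for t
  define Es where "Es t = measure_pmf.expectation (?law t) (\<lambda>z. (g z)\<^sup>2)" for t
  have sub: "set_pmf (?law t) \<subseteq> ?D" for t
    using \<mu> by (rule B.chain_law_subset)
  have mono: "measure_pmf.expectation (?law t) f1 \<le> measure_pmf.expectation (?law t) f2"
    if "\<And>z. z \<in> ?D \<Longrightarrow> f1 z \<le> f2 z" for f1 f2 :: "'n energy \<times> int \<Rightarrow> real" and t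
    unfolding B.expectation_eq_sum[OF sub] using that by (intro sum_mono mult_right_mono) auto
  have Es_Suc: "Es (Suc t) \<le> Es t - 2 * \<delta> * Eg t + C" for t
  proof -
    have "Es (Suc t) = measure_pmf.expectation (?law t) (B.P (\<lambda>z. (g z)\<^sup>2))"
      unfolding Es_def using B.expectation_bind[OF sub] by simp
    also have "\<dots> \<le> measure_pmf.expectation (?law t) (\<lambda>z. (g z)\<^sup>2 - 2 * \<delta> * g z + C)"
      by (rule mono) (rule drift)
    also have "\<dots> = (\<Sum>z\<in>?D. (g z)\<^sup>2 * pmf (?law t) z - 2 * \<delta> * (g z * pmf (?law t) z) + C * pmf (?law t) z)"
      unfolding B.expectation_eq_sum[OF sub] by (intro sum.cong) (auto simp: algebra_simps)
    also have "\<dots> = Es t - 2 * \<delta> * Eg t + C"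
      unfolding Es_def Eg_def B.expectation_eq_sum[OF sub]
      by (simp only: sum.distrib sum_subtractf sum_distrib_left[symmetric] B.sum_pmf_C[OF sub] mult_1_right)
    finally show ?thesis .
  qed
  \<comment> \<open>Summing the drift inequality telescopes the second moments; the final one is
    nonnegative and is dropped.\<close>
  have sum_Eg: "2 * \<delta> * (\<Sum>t<N. Eg t) \<le> Es 0 + real N * C" for N
  proof -
    have "Es N + 2 * \<delta> * (\<Sum>t<N. Eg t) \<le> Es 0 + real N * C"
    proof (induction N)
      case (Suc N)
      then show ?case using Es_Suc[of N] by (simp add: algebra_simps)
    qed simp
    moreover have "0 \<le> Es N"
      unfolding Es_def by (rule integral_nonneg_AE) simp
    ultimately show ?thesis by linarith
  qed
  have def: "LLR_defined K \<mu> ?p"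
    using bmax' \<mu> by (rule LLR_defined_threshold)
  have mean_loss: "(\<Sum>i\<in>UNIV. mean_loss K \<mu> ?p i t) \<le> M / (real bmax - M) * Eg t" for t
  proof -
    have "(\<Sum>i\<in>UNIV. mean_loss K \<mu> ?p i t) = measure_pmf.expectation (?law t) (\<lambda>z. \<Sum>i\<in>UNIV. loss i z)"
      unfolding mean_loss_threshold loss_def[symmetric] B.expectation_eq_sum[OF sub]
      by (simp only: sum_distrib_right sum.swap[of _ UNIV ?D])
    also have "\<dots> \<le> measure_pmf.expectation (?law t) (\<lambda>z. M / (real bmax - M) * g z)"
      by (rule mono) (rule loss_le)
    finally show ?thesis
      by (simp add: Eg_def)
  qed
  \<comment> \<open>The Markov factor of \<open>mean_loss\<close> divided by the factor
    \<open>2 * \<delta>\<close> of \<open>sum_Eg\<close>.\<close>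
  define c :: real where "c = M / (real bmax - M) / (2 * \<delta>)"
  have c: "0 \<le> c" using M \<delta> by (simp add: c_def)
  have "(\<lambda>T. \<Sum>i\<in>UNIV. time_avg (mean_loss K \<mu> ?p i) T) \<longlonglongrightarrow> LLR_sys K \<mu> ?p"
    using def unfolding LLR_sys_def LLR_def LLR_defined_def
    by (intro tendsto_sum) (simp add: convergent_LIMSEQ_iff)
  moreover have "time_avg (\<lambda>t. c * C) \<longlonglongrightarrow> c * C"
  proof (rule time_avg_tendsto, rule tendsto_eventually)
    show "\<forall>\<^sub>F N in sequentially. (\<Sum>t<N. c * C) / real N = c * C"
      using eventually_gt_at_top[of 0] by eventually_elim simp
  qed
  \<comment> \<open>\<open>Es 0\<close> may depend on \<open>bmax\<close> and on the initial law,
    but it disappears since \<open>T\<close> tends to infinity with \<open>bmax\<close>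
    fixed.\<close>
  then have "(\<lambda>T. c * Es 0 / real T + time_avg (\<lambda>t. c * C) T) \<longlonglongrightarrow> 0 + c * C"
    by (intro tendsto_add lim_const_over_n)
  moreover have "(\<Sum>i\<in>UNIV. time_avg (mean_loss K \<mu> ?p i) T)
      \<le> c * Es 0 / real T + time_avg (\<lambda>t. c * C) T" for T
  proof -
    have "(\<Sum>i\<in>UNIV. time_avg (mean_loss K \<mu> ?p i) T)
        = 1 / real T * (\<Sum>t<Suc T. \<Sum>i\<in>UNIV. mean_loss K \<mu> ?p i t)"
      unfolding time_avg_def atLeast0AtMost lessThan_Suc_atMost[symmetric]
      by (subst sum.swap) (simp only: sum_distrib_left)
    also have "\<dots> \<le> 1 / real T * (\<Sum>t<Suc T. M / (real bmax - M) * Eg t)"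
      by (intro mult_left_mono sum_mono mean_loss) simp
    also have "\<dots> = 1 / real T * (c * (2 * \<delta> * (\<Sum>t<Suc T. Eg t)))"
      unfolding sum_distrib_left[symmetric] c_def using \<delta> by simp
    also have "\<dots> \<le> 1 / real T * (c * (Es 0 + real (Suc T) * C))"
      using c by (intro mult_left_mono sum_Eg) auto
    also have "\<dots> = c * Es 0 / real T + time_avg (\<lambda>t. c * C) T"
      unfolding time_avg_def by (simp add: algebra_simps add_divide_distrib)
    finally show ?thesis .
  qed
  ultimately have "LLR_sys K \<mu> ?p \<le> 0 + c * C"
    by (intro LIMSEQ_le) auto
  then show ?thesis
    by (simp add: c_def mult.commute mult.left_commute)
qed

text \<open>\<open>h\<close>, \<open>\<delta>\<close> and \<open>H\<close> come from the chain of
  net generations alone, so one \<open>c\<close> serves all capacities and initial laws.\<close>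

lemma LLR_e_bounds:
  assumes "(\<Sum>i\<in>UNIV. drift S \<pi> i) > 0"
  obtains c where "c > 0" and "\<And>bmax \<mu>. 2 * M < int bmax \<Longrightarrow> set_pmf \<mu> \<subseteq> S \<times> {0..int bmax} \<Longrightarrow>
    0 \<le> LLR_e S K \<mu> bmax \<and> LLR_e S K \<mu> bmax \<le> ereal (c / (real bmax - M))"
proof -
  obtain h \<delta> where \<delta>: "\<delta> > 0"
    and h: "\<And>x. x \<in> S \<Longrightarrow> h x + \<delta> \<le> P h x + real_of_int (\<Sum>i\<in>UNIV. x i)"
    using positive_drift_potential[OF assms] by blast
  obtain H :: real where H: "H \<ge> 0" "\<And>x. x \<in> S \<Longrightarrow> \<bar>h x\<bar> \<le> H"
    using bounded_on_C by blast
  define C :: real where "C = (2 * H + M)\<^sup>2 + 4 * M * (M + 2 * H)"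
  \<comment> \<open>The summand 1 makes \<open>c\<close> strictly positive, as
    \<open>ereal_divide_ge\<close> requires later.\<close>
  define c :: real where "c = M * C / (2 * \<delta>) + 1"
  have M: "0 \<le> real_of_int M"
    using M_nonneg by simp
  then have "0 \<le> M * C / (2 * \<delta>)"
    unfolding C_def using H(1) \<delta> by (intro divide_nonneg_nonneg mult_nonneg_nonneg add_nonneg_nonneg) auto
  then have "c > 0" by (simp add: c_def)
  then show thesis
  proof (rule that)
    fix bmax :: nat and \<mu>
    assume bmax: "2 * M < int bmax" and \<mu>: "set_pmf \<mu> \<subseteq> S \<times> {0..int bmax}"
    have "LLR_sys K \<mu> (threshold_policy M bmax) \<le> M * C / (2 * \<delta> * (real bmax - M))"
      unfolding C_def using \<delta> h H(2) bmax \<mu> by (rule LLR_sys_threshold_le)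
    also have "\<dots> = (M * C / (2 * \<delta>)) / (real bmax - M)"
      by simp
    also have "\<dots> \<le> c / (real bmax - M)"
      using bmax M by (intro divide_right_mono) (auto simp: c_def)
    finally have "LLR_e S K \<mu> bmax \<le> ereal (c / (real bmax - M))"
      unfolding LLR_e_def using bmax \<mu>
      by (intro INF_lower2[of "threshold_policy M bmax"])
        (auto intro: threshold_policy_policies LLR_defined_threshold)
    moreover have "0 \<le> LLR_e S K \<mu> bmax"
      unfolding LLR_e_def LLR_sys_def using LLR_nonneg[OF _ \<mu>]
      by (intro INF_greatest) (auto intro: sum_nonneg)
    ultimately show "0 \<le> LLR_e S K \<mu> bmax \<and> LLR_e S K \<mu> bmax \<le> ereal (c / (real bmax - M))"
      by blast
  qed
qed

text \<open>The bound for each fair policy passes to the infimum, which over an empty set would be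
  \<open>\<infinity>\<close>.\<close>

lemma LLR_o_ge:
  assumes "set_pmf \<mu> \<subseteq> S \<times> {0..int bmax}"
  shows "ereal (- drift S \<pi> i) \<le> LLR_o S K \<mu> bmax"
  unfolding LLR_o_def using fair_LLR_sys_ge[OF _ assms]
  by (intro INF_greatest) auto

end

section \<open>Divergence of the price of fairness\<close>

lemma ereal_divide_ge:
  fixes x y :: ereal and d c :: real
  assumes "ereal d \<le> x" "0 \<le> y" "y \<le> ereal c" "0 < d" "0 < c"
  shows "ereal (d / c) \<le> x / y"
proof -
  \<comment> \<open>Inversion is antitone on nonnegative extended reals, with
    \<open>inverse 0 = \<infinity>\<close>; so \<open>y = 0\<close> is covered, as is
    \<open>x = \<infinity>\<close>.\<close>
  have "ereal d * inverse (ereal c) \<le> x * inverse y"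
    using assms by (intro ereal_mult_mono' ereal_inverse_antimono) auto
  then show ?thesis
    using assms(5) by (simp add: divide_ereal_def divide_inverse)
qed

theorem mainTheorem3:
  fixes Si :: "'n::finite \<Rightarrow> int set"
    and S :: "'n energy set"
    and K :: "'n kernel"
    and \<pi> :: "'n energy pmf"
    and init :: "nat \<Rightarrow> ('n energy \<times> int) pmf"
  assumes "\<And>i. finite (Si i)"
    and "\<And>i. Max (Si i) > 0"
    and "\<And>i. Min (Si i) < 0"
    and "finite S"
    and "S \<subseteq> {x. \<forall>i. x i \<in> Si i}"
    and "irreducible_chain S K"
    and "\<And>s. s \<in> S \<Longrightarrow> pmf (K s) s > 0"
    and "stationary S K \<pi>"
    and "\<And>bmax. set_pmf (init bmax) \<subseteq> S \<times> {0..int bmax}"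
    and "\<exists>i. drift S \<pi> i < 0"
    and "(\<Sum>i\<in>UNIV. drift S \<pi> i) > 0"
  shows "(\<lambda>bmax. price_of_fairness S K (init bmax) bmax) \<longlonglongrightarrow> \<infinity>"
proof -
  interpret battery_sharing S K \<pi>
    using assms(4,6,8) by unfold_locales (auto simp: irreducible_chain_def)
  obtain i where i: "drift S \<pi> i < 0"
    using assms(10) by blast
  obtain c where c: "c > 0" and LLR_e: "\<And>bmax. 2 * M < int bmax \<Longrightarrow>
      0 \<le> LLR_e S K (init bmax) bmax \<and> LLR_e S K (init bmax) bmax \<le> ereal (c / (real bmax - M))"
    by (rule LLR_e_bounds[OF assms(11)]) (use assms(9) in blast)
  have M: "0 \<le> real_of_int M"
    using M_nonneg by simp
  show ?thesis
    unfolding tendsto_PInfty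
  proof
    fix r :: real
    \<comment> \<open>The first entry makes the bound on \<open>LLR_e\<close> applicable; the second
      is \<open>r < - drift S \<pi> i / (c / (bmax - M))\<close> solved for
      \<open>bmax\<close>.\<close>
    define B where "B = max (2 * real_of_int M) (r * c / (- drift S \<pi> i) + M)"
    have "ereal r < price_of_fairness S K (init bmax) bmax" if "B < real bmax" for bmax
    proof -
      have bmax: "2 * real_of_int M < real bmax" "r * c / (- drift S \<pi> i) < real bmax - M"
        using that by (auto simp: B_def)
      have pos: "0 < real bmax - M" using bmax(1) M by linarith
      have "r < - drift S \<pi> i / (c / (real bmax - M))"
        using bmax(2) c i by (simp add: field_simps)
      then have "ereal r < ereal (- drift S \<pi> i / (c / (real bmax - M)))"
        by simp
      also have "\<dots> \<le> price_of_fairness S K (init bmax) bmax"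
        unfolding price_of_fairness_def
      proof (rule ereal_divide_ge)
        show "ereal (- drift S \<pi> i) \<le> LLR_o S K (init bmax) bmax"
          using assms(9) by (rule LLR_o_ge)
        have "2 * M < int bmax"
          using bmax(1) by linarith
        then show "0 \<le> LLR_e S K (init bmax) bmax"
          and "LLR_e S K (init bmax) bmax \<le> ereal (c / (real bmax - M))"
          using LLR_e by blast+
      qed (use i c pos in simp_all)
      finally show ?thesis .
    qed
    moreover have "\<forall>\<^sub>F bmax in sequentially. B < real bmax"
      using filterlim_real_sequentially by (simp add: filterlim_at_top_dense)
    ultimately show "\<forall>\<^sub>F bmax in sequentially. ereal r < price_of_fairness S K (init bmax) bmax"
      by (auto elim: eventually_mono)
  qed
qed

end
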